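(* Let $\mathcal{J}''(m,n)$ be the number of 001-partitions of $n$ of length $m$. Then, as formal power series in $z$ and $q$, $$\sum_{m,n\geq 0}\mathcal{J}''(m,n)\, z^m q^n = \frac{(-z^2q;q^2)_\infty}{(zq;q)_\infty\,(z^3q;q^3)_\infty\,(z^3q^2;q^3)_\infty}.$$
   Context: A 001-partition of a non-negative integer $n$ of length $m$ is a sequence $(n_1,\dots,n_m)$ of non-negative integers with $\sum_i n_i = n$, last entry $n_m \geq 1$ (when $m\ge1$), and $n_j \geq n_{j+1}-1$, $n_j \geq n_{j+2}-1$, $n_j \geq n_{j+3}$ whenever the indices are in range. The empty sequence is the unique 001-partition of length $0$ (of $n=0$). Notation: $(a;q)_\infty = \prod_{i\ge0}(1-aq^i)$. *)

theory Defs
  imports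
    "HOL-Analysis.Infinite_Products"
    "HOL-Computational_Algebra.Formal_Power_Series"
begin

text \<open>
  Sequences are lists, so the entry \<open>n\<^sub>j\<close> is \<open>ns ! (j - 1)\<close>. The conditions
  \<open>n\<^sub>j \<ge> n\<^bsub>j+1\<^esub> - 1\<close> and \<open>n\<^sub>j \<ge> n\<^bsub>j+2\<^esub> - 1\<close> are written without the truncated subtraction on \<open>nat\<close>.
\<close>

definition is_001_partition :: "nat list \<Rightarrow> bool" where
  "is_001_partition ns \<longleftrightarrow>
     (ns \<noteq> [] \<longrightarrow> last ns \<ge> 1) \<and>
     (\<forall>j. j + 1 < length ns \<longrightarrow> ns ! j + 1 \<ge> ns ! (j + 1)) \<and>
     (\<forall>j. j + 2 < length ns \<longrightarrow> ns ! j + 1 \<ge> ns ! (j + 2)) \<and>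
     (\<forall>j. j + 3 < length ns \<longrightarrow> ns ! j \<ge> ns ! (j + 3))"

definition partitions_001 :: "nat \<Rightarrow> nat \<Rightarrow> nat list set" where
  "partitions_001 m n = {ns. is_001_partition ns \<and> length ns = m \<and> sum_list ns = n}"

definition J'' :: "nat \<Rightarrow> nat \<Rightarrow> nat" where
  "J'' m n = card (partitions_001 m n)"

lemma finite_partitions_001: "finite (partitions_001 m n)"
proof (rule finite_subset)
  show "partitions_001 m n \<subseteq> {ns. set ns \<subseteq> {..n} \<and> length ns = m}"
    using member_le_sum_list by (fastforce simp: partitions_001_def)
  show "finite {ns. set ns \<subseteq> {..n} \<and> length ns = m}"
    by (simp add: finite_lists_length_eq)
qed

text \<open>
  Power series in \<open>z\<close> and \<open>q\<close> over the rationals are represented as power series in \<open>q\<close> whose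
  coefficients are power series in \<open>z\<close>. This nesting order matters: the topology on
  \<^typ>\<open>'a fps\<close> is that of the outer variable with discrete coefficients, and the products below
  converge \<open>q\<close>-adically but not \<open>z\<close>-adically. Rational coefficients make the library's power series
  division available; a denominator whose \<open>q\<^sup>0\<close>-coefficient is \<open>1\<close> is a unit, so dividing by it is
  multiplying by its inverse.
\<close>

definition z_var :: "rat fps fps" where
  "z_var = fps_const fps_X"

definition q_var :: "rat fps fps" where
  "q_var = fps_X"

definition qpoch_inf :: "'a \<Rightarrow> 'a \<Rightarrow> 'a :: {t2_space, comm_ring_1}" where
  "qpoch_inf a q = (\<Prod>i. 1 - a * q ^ i)"

lemma has_prod_qpoch_inf:
  fixes a q :: "'a :: idom fps"
  assumes a: "fps_nth a 0 = 0" and q: "fps_nth q 0 = 0"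
  shows "(\<lambda>i. 1 - a * q ^ i) has_prod qpoch_inf a q"
proof -
  define P where "P = (\<lambda>n. \<Prod>i\<le>n. 1 - a * q ^ i)"
  define L where "L = Abs_fps (\<lambda>N. fps_nth (P N) N)"
  have q_pow: "fps_nth (q ^ n) k = 0" if "k < n" for n k
    using startsby_zero_power_prefix[OF q] that by blast
  have step: "fps_nth (P (Suc n)) N = fps_nth (P n) N" if "N \<le> n" for n N
  proof -
    have "P (Suc n) = P n - (P n * a) * q ^ Suc n"
      by (simp add: P_def algebra_simps)
    moreover have "fps_nth ((P n * a) * q ^ Suc n) N = 0"
      using that unfolding fps_mult_nth[of _ "q ^ Suc n"]
      by (intro sum.neutral ballI) (auto simp: q_pow simp del: power_Suc)
    ultimately show ?thesis by simp
  qed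
  have "fps_nth (P n) N = fps_nth L N" if "N \<le> n" for n N
    using that by (induction n rule: dec_induct) (simp_all add: L_def step)
  then have "P \<longlonglongrightarrow> L"
    by (intro tendsto_fpsI) (auto simp: eventually_sequentially)
  moreover have "fps_nth L 0 = 1"
    by (simp add: L_def P_def a)
  then have "L \<noteq> 0" by auto
  ultimately have "raw_has_prod (\<lambda>i. 1 - a * q ^ i) 0 L"
    by (simp add: raw_has_prod_def P_def)
  then show ?thesis
    unfolding qpoch_inf_def
    by (metis has_prod_def has_prod_unique)
qed

definition fps2 :: "(nat \<Rightarrow> nat \<Rightarrow> rat) \<Rightarrow> rat fps fps" where
  "fps2 c = Abs_fps (\<lambda>n. Abs_fps (\<lambda>m. c m n))"

lemma fps2_nth: "fps_nth (fps_nth (fps2 c) n) m = c m n"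
  by (simp add: fps2_def)

end

theory Submission
  imports Defs
begin

text \<open>
  A 001-partition splits uniquely as \<open>map Suc ps @ t\<close>, where \<open>ps\<close> is again a 001-partition and
  \<open>t\<close> is a 001-partition with entries at most \<open>1\<close>: cut after the last entry that exceeds \<open>1\<close>;
  the conditions force every entry before it to be positive. Hence the generating function
  satisfies \<open>F(z) = W(z) F(zq)\<close>, where \<open>W\<close> counts the 0/1-valued 001-partitions. A transfer
  argument over the first three entries yields
  \<open>W(z) = (1 + z\<^sup>2q) / ((1 - zq)(1 - z\<^sup>3q)(1 - z\<^sup>3q\<^sup>2))\<close>, and iterating the functional equation
  gives the product.
\<close>

section \<open>Generating functions of sets of lists\<close>

definition list_gf :: "nat list set \<Rightarrow> rat fps fps" where
  "list_gf L = fps2 (\<lambda>m n. of_nat (card {xs \<in> L. length xs = m \<and> sum_list xs = n}))"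

lemma list_gf_nth:
  "fps_nth (fps_nth (list_gf L) n) m = of_nat (card {xs \<in> L. length xs = m \<and> sum_list xs = n})"
  by (simp add: list_gf_def fps2_nth)

lemma finite_lists_length_sum:
  "finite {xs :: nat list. xs \<in> L \<and> length xs = m \<and> sum_list xs = n}"
proof (rule finite_subset)
  show "{xs. xs \<in> L \<and> length xs = m \<and> sum_list xs = n} \<subseteq> {xs. set xs \<subseteq> {..n} \<and> length xs = m}"
    using member_le_sum_list by fastforce
qed (simp add: finite_lists_length_eq)

lemma list_gf_Un:
  assumes "A \<inter> B = {}"
  shows "list_gf (A \<union> B) = list_gf A + list_gf B"
proof (intro fps_ext)
  fix n m
  have "{xs \<in> A \<union> B. length xs = m \<and> sum_list xs = n} =
      {xs \<in> A. length xs = m \<and> sum_list xs = n} \<union> {xs \<in> B. length xs = m \<and> sum_list xs = n}"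
    by auto
  then have "card {xs \<in> A \<union> B. length xs = m \<and> sum_list xs = n} =
      card {xs \<in> A. length xs = m \<and> sum_list xs = n} + card {xs \<in> B. length xs = m \<and> sum_list xs = n}"
    using assms by (simp add: card_Un_disjoint finite_lists_length_sum disjoint_iff)
  then show "fps_nth (fps_nth (list_gf (A \<union> B)) n) m = fps_nth (fps_nth (list_gf A + list_gf B) n) m"
    by (simp add: list_gf_nth)
qed

text \<open>Injectivity makes the two factors of a word unique. Sorting words by the sum and length
  of the first factor then gives the double Cauchy product, outer in \<open>q_var\<close> and inner
  in \<open>z_var\<close>.\<close>

lemma list_gf_append:
  assumes inj: "inj_on (\<lambda>(u, v). u @ v) (A \<times> B)"
  shows "list_gf ((\<lambda>(u, v). u @ v) ` (A \<times> B)) = list_gf A * list_gf B"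
proof (intro fps_ext)
  fix n m
  let ?L = "\<lambda>L m n. {xs \<in> L. length xs = m \<and> sum_list xs = (n::nat)}"
  \<comment> \<open>Here \<open>p\<close> is the pair (sum, length) of the first factor.\<close>
  let ?S = "SIGMA p : {0..n} \<times> {0..m}. ?L A (snd p) (fst p) \<times> ?L B (m - snd p) (n - fst p)"
  have "bij_betw (\<lambda>(p, u, v). u @ v) ?S (?L ((\<lambda>(u, v). u @ v) ` (A \<times> B)) m n)"
    unfolding bij_betw_def
  proof
    show "inj_on (\<lambda>(p, u, v). u @ v) ?S"
    proof (rule inj_onI, clarify)
      fix i j i' j' :: nat and u v u' v' :: "nat list"
      assume "u \<in> A" "v \<in> B" "u' \<in> A" "v' \<in> B" "u @ v = u' @ v'"
        and "length u = snd (i, j)" "sum_list u = fst (i, j)"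
        and "length u' = snd (i', j')" "sum_list u' = fst (i', j')"
      then show "(i, j) = (i', j') \<and> (u, v) = (u', v')"
        using inj_onD[OF inj, of "(u, v)" "(u', v')"] by simp
    qed
    show "(\<lambda>(p, u, v). u @ v) ` ?S = ?L ((\<lambda>(u, v). u @ v) ` (A \<times> B)) m n"
    proof (intro equalityI subsetI)
      fix w assume "w \<in> ?L ((\<lambda>(u, v). u @ v) ` (A \<times> B)) m n"
      then obtain u v where uv: "u \<in> A" "v \<in> B" "w = u @ v" "length w = m" "sum_list w = n"
        by auto
      then have "((sum_list u, length u), u, v) \<in> ?S"
        and "w = (\<lambda>(p, u, v). u @ v) ((sum_list u, length u), u, v)"
        by auto
      then show "w \<in> (\<lambda>(p, u, v). u @ v) ` ?S"
        by (rule rev_image_eqI)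
    qed auto
  qed
  then have "card (?L ((\<lambda>(u, v). u @ v) ` (A \<times> B)) m n) = card ?S"
    by (simp add: bij_betw_same_card)
  also have "\<dots> = (\<Sum>j = 0..n. \<Sum>i = 0..m. card (?L A i j) * card (?L B (m - i) (n - j)))"
    by (subst card_SigmaI)
       (auto simp: finite_lists_length_sum card_cartesian_product sum.cartesian_product case_prod_beta)
  finally show "fps_nth (fps_nth (list_gf ((\<lambda>(u, v). u @ v) ` (A \<times> B))) n) m =
      fps_nth (fps_nth (list_gf A * list_gf B) n) m"
    by (simp add: list_gf_nth fps_mult_nth fps_sum_nth)
qed

lemma list_gf_singleton: "list_gf {xs} = z_var ^ length xs * q_var ^ sum_list xs"
proof (intro fps_ext)
  fix n m
  have "{ys \<in> {xs}. length ys = m \<and> sum_list ys = n} =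
      (if length xs = m \<and> sum_list xs = n then {xs} else {})"
    by auto
  then show "fps_nth (fps_nth (list_gf {xs}) n) m =
      fps_nth (fps_nth (z_var ^ length xs * q_var ^ sum_list xs) n) m"
    by (simp add: list_gf_nth z_var_def q_var_def fps_const_power fps_X_power_nth)
qed

lemma list_gf_Cons: "list_gf ((#) x ` L) = z_var * q_var ^ x * list_gf L"
proof -
  have "{[x]} \<times> L = Pair [x] ` L"
    by auto
  then have eq: "(#) x ` L = (\<lambda>(u, v). u @ v) ` ({[x]} \<times> L)"
    by (simp add: image_image)
  have "inj_on (\<lambda>(u, v). u @ v) ({[x]} \<times> L)"
    by (rule inj_onI) auto
  then show ?thesis
    unfolding eq by (simp add: list_gf_append list_gf_singleton)
qed

section \<open>Splitting 001-partitions\<close>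

text \<open>The inequalities reach at most three entries ahead, so these four shapes settle what a
  prepended entry must satisfy.\<close>

lemma list_cases3:
  obtains "t = []" | a where "t = [a]" | a b where "t = [a, b]" | a b c r where "t = a # b # c # r"
  by (metis list.exhaust)

lemma is_001_Nil [simp]: "is_001_partition []"
  by (simp add: is_001_partition_def)

lemma is_001_Cons:
  "is_001_partition (x # t) \<longleftrightarrow> is_001_partition t \<and> (t = [] \<longrightarrow> x \<ge> 1) \<and>
     (length t > 0 \<longrightarrow> x + 1 \<ge> t ! 0) \<and> (length t > 1 \<longrightarrow> x + 1 \<ge> t ! 1) \<and>
     (length t > 2 \<longrightarrow> x \<ge> t ! 2)"
proof -
  have split: "(\<forall>j. P j) \<longleftrightarrow> P 0 \<and> (\<forall>j. P (Suc j))" for P :: "nat \<Rightarrow> bool"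
    by (metis not0_implies_Suc)
  show ?thesis
    unfolding is_001_partition_def
    by (subst (1 2 3) split) (auto simp: numeral_2_eq_2 numeral_3_eq_3)
qed

lemma is_001_simps:
  "is_001_partition [x] \<longleftrightarrow> x \<ge> 1"
  "is_001_partition [x, a] \<longleftrightarrow> a \<ge> 1 \<and> x + 1 \<ge> a"
  "is_001_partition [x, a, b] \<longleftrightarrow> b \<ge> 1 \<and> a + 1 \<ge> b \<and> x + 1 \<ge> a \<and> x + 1 \<ge> b"
  "is_001_partition (x # a # b # c # r) \<longleftrightarrow>
     is_001_partition (a # b # c # r) \<and> x + 1 \<ge> a \<and> x + 1 \<ge> b \<and> x \<ge> c"
  by (simp_all add: is_001_Cons[of x] is_001_Cons[of a "[]"] is_001_Cons[of a "[b]"]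
        is_001_Cons[of b "[]"] conj_ac)

definition partitions_001_01 :: "nat list set" where
  "partitions_001_01 = {t. is_001_partition t \<and> set t \<subseteq> {..1}}"

lemma is_001_last: "is_001_partition ns \<Longrightarrow> ns \<noteq> [] \<Longrightarrow> last ns \<ge> 1"
  by (simp add: is_001_partition_def)

text \<open>The splitting is built from the right: a prepended \<open>x\<close> joins
  \<open>t\<close> if \<open>ps\<close> is empty and \<open>x \<le> 1\<close>; otherwise
  \<open>x - 1\<close> is prepended to \<open>ps\<close>.\<close>

lemma is_001_split:
  "is_001_partition ns \<Longrightarrow>
    \<exists>ps t. ns = map Suc ps @ t \<and> is_001_partition ps \<and> t \<in> partitions_001_01"
proof (induction ns)
  case Nil
  then show ?case by (simp add: partitions_001_01_def)
next
  case (Cons x ns)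
  then obtain ps t where split: "ns = map Suc ps @ t" "is_001_partition ps" "t \<in> partitions_001_01"
    by (meson is_001_Cons)
  show ?case
  proof (cases "ps = [] \<and> x \<le> 1")
    case True
    then have "x # ns = map Suc [] @ (x # t) \<and> x # t \<in> partitions_001_01"
      using split Cons.prems by (simp add: partitions_001_01_def)
    then show ?thesis using is_001_Nil by blast
  next
    case False
    have "0 < length ns \<longrightarrow> x + 1 \<ge> ns ! 0" "1 < length ns \<longrightarrow> x + 1 \<ge> ns ! 1"
      "2 < length ns \<longrightarrow> x \<ge> ns ! 2"
      using Cons.prems unfolding is_001_Cons by blast+
    \<comment> \<open>If \<open>ps\<close> is empty, then \<open>x \<ge> 2\<close>. If it has one or
      two entries, its last is at least 1, so \<open>x + 1 \<ge> 2\<close>. If it has three or more,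
      \<open>x\<close> is at least the successor of the third.\<close>
    then have "x \<ge> 1 \<and> is_001_partition ((x - 1) # ps)"
      using False split(2) unfolding split(1)
      by (cases ps rule: list_cases3) (simp_all add: is_001_simps)
    then have "x # ns = map Suc ((x - 1) # ps) @ t \<and> is_001_partition ((x - 1) # ps)"
      using split by simp
    then show ?thesis using split(3) by blast
  qed
qed

text \<open>Conditions within \<open>ps\<close> survive a common shift, and those reaching into
  \<open>t\<close> compare an entry of at least 1 with one of at most 1.\<close>

lemma is_001_append:
  assumes "t \<in> partitions_001_01"
  shows "is_001_partition ps \<Longrightarrow> is_001_partition (map Suc ps @ t)"
proof (induction ps)
  case Nil
  then show ?case using assms by (simp add: partitions_001_01_def)
next
  case (Cons a ps)
  have "t ! i \<le> 1" if "i < length t" for i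
    using assms nth_mem[OF that] by (auto simp: partitions_001_01_def)
  then have le: "i < length t \<longrightarrow> t ! i \<le> Suc a" for i
    using le_SucI by fastforce
  have "is_001_partition (map Suc ps @ t)"
    using Cons by (simp add: is_001_Cons)
  then show ?case
    using Cons.prems le[of 0] le[of 1] le[of 2] unfolding list.map append_Cons is_001_Cons[of _ "_ @ _"]
    by (cases ps rule: list_cases3) (simp_all add: is_001_simps le_SucI)
qed

text \<open>If only one of \<open>ps\<close>, \<open>ps'\<close> were empty, the last entry of the
  other, at least 1, would appear incremented among the 0/1 entries of the opposite tail.\<close>

lemma is_001_split_unique:
  assumes "is_001_partition ps" "is_001_partition ps'"
    and "t \<in> partitions_001_01" "t' \<in> partitions_001_01"
    and "map Suc ps @ t = map Suc ps' @ t'"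
  shows "ps = ps' \<and> t = t'"
  using assms
proof (induction ps ps' rule: list_induct2')
  case (2 x xs)
  then have "Suc (last (x # xs)) \<in> set t'"
    by (metis append_self_conv2 image_eqI last_in_set list.distinct(1) list.set_map
        list.simps(8) set_append UnCI)
  then show ?case
    using 2 is_001_last[of "x # xs"] by (auto simp: partitions_001_01_def simp del: last.simps)
next
  case (3 y ys)
  then have "Suc (last (y # ys)) \<in> set t"
    by (metis append_self_conv2 image_eqI last_in_set list.distinct(1) list.set_map
        list.simps(8) set_append UnCI)
  then show ?case
    using 3 is_001_last[of "y # ys"] by (auto simp: partitions_001_01_def simp del: last.simps)
next
  case (4 x xs y ys)
  then show ?case by (auto simp: is_001_Cons)
qed auto

text \<open>Adding \<open>k\<close> to all \<open>m\<close> entries raises the sum by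
  \<open>k * m\<close>, so this is the generating function with z replaced by z q^k, without formal
  substitution.\<close>

definition shifted_gf :: "nat \<Rightarrow> nat list set \<Rightarrow> rat fps fps" where
  "shifted_gf k L = list_gf (map ((+) k) ` L)"

text \<open>This is F(z q^k) = F(z q^(k+1)) W(z q^k): shifting \<open>map Suc ps @ t\<close> by
  \<open>k\<close> shifts \<open>ps\<close> by \<open>Suc k\<close> and \<open>t\<close> by
  \<open>k\<close>, and the splitting is unique.\<close>

lemma shifted_gf_001_step:
  "shifted_gf k (Collect is_001_partition) =
    shifted_gf (Suc k) (Collect is_001_partition) * shifted_gf k partitions_001_01"
proof -
  let ?P = "Collect is_001_partition" and ?T = partitions_001_01
  let ?A = "map ((+) (Suc k)) ` ?P" and ?B = "map ((+) k) ` ?T"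
  have eq: "map ((+) (Suc k)) ps @ map ((+) k) t = map ((+) k) (map Suc ps @ t)" for ps t
    by simp
  have P: "?P = (\<lambda>(ps, t). map Suc ps @ t) ` (?P \<times> ?T)"
    using is_001_split is_001_append by (fastforce simp: image_iff)
  have "map ((+) k) ` ?P = map ((+) k) ` (\<lambda>(ps, t). map Suc ps @ t) ` (?P \<times> ?T)"
    using P by (rule arg_cong)
  also have "\<dots> = (\<lambda>(u, v). u @ v) ` map_prod (map ((+) (Suc k))) (map ((+) k)) ` (?P \<times> ?T)"
    unfolding image_image by (intro image_cong refl) (auto simp flip: eq)
  also have "map_prod (map ((+) (Suc k))) (map ((+) k)) ` (?P \<times> ?T) = ?A \<times> ?B"
    by (intro map_prod_surj_on refl)
  finally have "map ((+) k) ` ?P = (\<lambda>(u, v). u @ v) ` (?A \<times> ?B)" .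
  moreover have "inj_on (\<lambda>(u, v). u @ v) (?A \<times> ?B)"
  proof (rule inj_onI, clarify)
    fix ps t ps' t'
    assume "is_001_partition ps" "is_001_partition ps'" "t \<in> ?T" "t' \<in> ?T"
      and "map ((+) (Suc k)) ps @ map ((+) k) t = map ((+) (Suc k)) ps' @ map ((+) k) t'"
    moreover from this(5) have "map Suc ps @ t = map Suc ps' @ t'"
      unfolding eq by (subst (asm) inj_map_eq_map) (simp_all add: inj_on_def)
    ultimately show "map ((+) (Suc k)) ps = map ((+) (Suc k)) ps' \<and> map ((+) k) t = map ((+) k) t'"
      using is_001_split_unique by blast
  qed
  ultimately show ?thesis
    unfolding shifted_gf_def using list_gf_append by metis
qed

section \<open>The 0/1-valued 001-partitions\<close>

lemma shifted_gf_Un: "A \<inter> B = {} \<Longrightarrow> shifted_gf k (A \<union> B) = shifted_gf k A + shifted_gf k B"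
  unfolding shifted_gf_def image_Un
  by (intro list_gf_Un) (auto simp: inj_map_eq_map)

lemma shifted_gf_Cons: "shifted_gf k ((#) x ` L) = z_var * q_var ^ (k + x) * shifted_gf k L"
proof -
  have "map ((+) k) ` (#) x ` L = (#) (k + x) ` map ((+) k) ` L"
    by (simp add: image_image)
  then show ?thesis by (simp add: shifted_gf_def list_gf_Cons)
qed

text \<open>States of the transfer argument. Padding with zeros gives lists shorter than three a
  state too.\<close>

definition starts :: "nat \<Rightarrow> nat \<Rightarrow> nat \<Rightarrow> nat list set" where
  "starts a b c = {t \<in> partitions_001_01. take 3 (t @ [0, 0, 0]) = [a, b, c]}"

lemma starts_disjoint: "(a, b, c) \<noteq> (a', b', c') \<Longrightarrow> starts a b c \<inter> starts a' b' c' = {}"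
  by (auto simp: starts_def)

text \<open>After three zeros the condition three places ahead forces every later entry to be 0,
  contradicting a positive last entry.\<close>

lemma not_is_001_zeros: "\<not> is_001_partition (0 # 0 # 0 # r)"
  by (induction r) (auto simp: is_001_Cons)

lemma starts_000: "starts 0 0 0 = {[]}"
proof -
  have "t = []" if "t \<in> starts 0 0 0" for t
    using that not_is_001_zeros
    by (cases t rule: list_cases3)
       (auto simp: starts_def partitions_001_01_def is_001_simps(1-3))
  then show ?thesis by (auto simp: starts_def partitions_001_01_def)
qed

text \<open>Among 0/1 entries only the condition three places ahead restricts: a 0 forces a 0 there,
  a 1 allows both. The state of three zeros is excluded because it consists of the empty list, which
  has no head.\<close>

lemma starts_step:
  assumes "(x, a, b) \<noteq> (0, 0, 0)" "x \<le> 1"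
  shows "starts x a b = (#) x ` (starts a b 0 \<union> (if x = 0 then {} else starts a b 1))"
proof (intro equalityI subsetI)
  fix t assume t: "t \<in> starts x a b"
  then obtain y u where tu: "t = y # u"
    using assms by (cases t) (auto simp: starts_def)
  have "y = x \<and> u \<in> starts a b 0 \<union> (if x = 0 then {} else starts a b 1)"
    using t unfolding tu
    by (cases u rule: list_cases3)
       (auto simp: starts_def partitions_001_01_def is_001_simps)
  then show "t \<in> (#) x ` (starts a b 0 \<union> (if x = 0 then {} else starts a b 1))"
    using tu by blast
next
  fix t assume "t \<in> (#) x ` (starts a b 0 \<union> (if x = 0 then {} else starts a b 1))"
  then obtain u where tu: "t = x # u" "u \<in> starts a b 0 \<or> x \<noteq> 0 \<and> u \<in> starts a b 1"
    by (auto split: if_splits)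
  then show "t \<in> starts x a b"
    using assms
    by (cases u rule: list_cases3)
       (auto simp: starts_def partitions_001_01_def is_001_simps)
qed

lemma partitions_001_01_eq:
  "partitions_001_01 = starts 0 0 0 \<union> (starts 0 0 1 \<union> (starts 0 1 0 \<union> (starts 0 1 1 \<union>
     (starts 1 0 0 \<union> (starts 1 0 1 \<union> (starts 1 1 0 \<union> starts 1 1 1))))))"
proof -
  have "t \<in> starts 0 0 0 \<union> (starts 0 0 1 \<union> (starts 0 1 0 \<union> (starts 0 1 1 \<union>
     (starts 1 0 0 \<union> (starts 1 0 1 \<union> (starts 1 1 0 \<union> starts 1 1 1))))))"
    if "t \<in> partitions_001_01" for t
    using that
    by (cases t rule: list_cases3) (auto simp: starts_def partitions_001_01_def le_Suc_eq)
  then show ?thesis by (auto simp: starts_def)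
qed

text \<open>The formula for W at z q^k. Prepending entries gives linear equations between the
  states; eliminating all but 100, 110 and 111 leaves a triangular system whose diagonal entries are
  the three factors on the left.\<close>

lemma shifted_gf_01:
  fixes k
  defines "u \<equiv> z_var * q_var ^ k"
  shows "(1 - u * q_var) * (1 - u ^ 3 * q_var) * (1 - u ^ 3 * q_var ^ 2) *
    shifted_gf k partitions_001_01 = 1 + u ^ 2 * q_var"
proof -
  define W where "W a b c = shifted_gf k (starts a b c)" for a b c
  have W0: "W 0 0 0 = 1"
    by (simp add: W_def starts_000 shifted_gf_def list_gf_singleton)
  \<comment> \<open>A prepended 0 has weight \<open>u\<close> after the shift by \<open>k\<close>, a
    prepended 1 has weight \<open>u * q_var\<close>.\<close>
  have step0: "W 0 a b = u * W a b 0" if "(a, b) \<noteq> (0, 0)" for a b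
    using that by (simp add: W_def starts_step shifted_gf_Cons u_def)
  have step1: "W 1 a b = u * q_var * (W a b 0 + W a b 1)" for a b
    using shifted_gf_Un[OF starts_disjoint[of a b 0 a b 1]]
    by (simp add: W_def starts_step shifted_gf_Cons u_def mult_ac)
  have "shifted_gf k partitions_001_01 = W 0 0 0 + (W 0 0 1 + (W 0 1 0 + (W 0 1 1 +
      (W 1 0 0 + (W 1 0 1 + (W 1 1 0 + W 1 1 1))))))"
    unfolding partitions_001_01_eq W_def
    by (subst shifted_gf_Un, (simp add: Int_Un_distrib starts_disjoint; fail))+ simp
  moreover have W0s: "W 0 1 0 = u * W 1 0 0" "W 0 1 1 = u * W 1 1 0"
    by (simp_all add: step0)
  moreover from this have W001: "W 0 0 1 = u ^ 2 * W 1 0 0"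
    by (simp add: step0 power2_eq_square)
  moreover have W101: "W 1 0 1 = u ^ 2 * q_var * (W 1 0 0 + W 1 1 0)"
    unfolding step1[of 0 1] W0s by (simp add: algebra_simps power2_eq_square)
  ultimately have W: "shifted_gf k partitions_001_01 = 1 + (1 + u + u ^ 2 + u ^ 2 * q_var) * W 1 0 0 +
      (1 + u + u ^ 2 * q_var) * W 1 1 0 + W 1 1 1"
    by (simp add: W0 algebra_simps)
  have A: "(1 - u ^ 3 * q_var) * W 1 0 0 = u * q_var"
    using step1[of 0 0] unfolding W0 W001 by (simp add: algebra_simps power2_eq_square power3_eq_cube)
  have B: "(1 - u ^ 3 * q_var ^ 2) * W 1 1 0 = u * q_var * (1 + u ^ 2 * q_var) * W 1 0 0"
    using step1[of 1 0] unfolding W101 by (simp add: algebra_simps power2_eq_square power3_eq_cube)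
  have C: "(1 - u * q_var) * W 1 1 1 = u * q_var * W 1 1 0"
    using step1[of 1 1] by (simp add: algebra_simps)
  \<comment> \<open>Named factors stay atomic while the product is distributed; each unknown then
    meets the factors that \<open>C\<close>, \<open>B\<close> and \<open>A\<close>, applied in this
    order, eliminate.\<close>
  define D1 D2 D3 where D: "D1 = 1 - u * q_var" "D2 = 1 - u ^ 3 * q_var" "D3 = 1 - u ^ 3 * q_var ^ 2"
  have "D1 * D2 * D3 * shifted_gf k partitions_001_01 = D1 * D2 * D3 +
      (1 + u + u ^ 2 + u ^ 2 * q_var) * D1 * D3 * (D2 * W 1 0 0) +
      (1 + u + u ^ 2 * q_var) * D1 * (D2 * (D3 * W 1 1 0)) + D2 * (D3 * (D1 * W 1 1 1))"
    unfolding W by (simp only: distrib_left distrib_right mult_1_left mult_1_right mult_ac)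
  also have "D2 * (D3 * (D1 * W 1 1 1)) = u * q_var * (D2 * (D3 * W 1 1 0))"
    using C by (simp add: D(1) mult_ac)
  also have "D2 * (D3 * W 1 1 0) = u * q_var * (1 + u ^ 2 * q_var) * (D2 * W 1 0 0)"
    using B by (simp add: D(3) mult_ac)
  also have "D2 * W 1 0 0 = u * q_var"
    using A by (simp add: D(2))
  also have "D1 * D2 * D3 + (1 + u + u ^ 2 + u ^ 2 * q_var) * D1 * D3 * (u * q_var) +
      (1 + u + u ^ 2 * q_var) * D1 * (u * q_var * (1 + u ^ 2 * q_var) * (u * q_var)) +
      u * q_var * (u * q_var * (1 + u ^ 2 * q_var) * (u * q_var)) = 1 + u ^ 2 * q_var"
    unfolding D by (simp add: algebra_simps power2_eq_square power3_eq_cube)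
  finally show ?thesis unfolding D .
qed

section \<open>Iterating the functional equation\<close>

text \<open>Coefficient \<open>n\<close> of a product depends only on the coefficients up to
  \<open>n\<close> of the factors, finitely many eventually constant values.\<close>

lemma tendsto_fps_mult:
  fixes f g :: "'b \<Rightarrow> 'a :: ring fps"
  assumes "(f \<longlongrightarrow> A) F" "(g \<longlongrightarrow> B) F"
  shows "((\<lambda>x. f x * g x) \<longlongrightarrow> A * B) F"
proof (rule tendsto_fpsI)
  fix n
  have "\<forall>\<^sub>F x in F. (\<forall>i\<in>{..n}. fps_nth (f x) i = fps_nth A i) \<and> (\<forall>i\<in>{..n}. fps_nth (g x) i = fps_nth B i)"
    using assms unfolding tendsto_fps_iff by (auto intro!: eventually_conj eventually_ball_finite)
  then show "\<forall>\<^sub>F x in F. fps_nth (f x * g x) n = fps_nth (A * B) n"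
    by eventually_elim (simp add: fps_mult_nth)
qed

text \<open>A nonempty list shifted by \<open>k\<close> has sum at least \<open>k\<close>, so for
  \<open>k > n\<close> only the empty list can contribute to coefficient \<open>n\<close>.\<close>

lemma tendsto_shifted_gf_001: "(\<lambda>k. shifted_gf k (Collect is_001_partition)) \<longlonglongrightarrow> 1"
proof (rule tendsto_fpsI)
  fix n
  have "fps_nth (shifted_gf k (Collect is_001_partition)) n = fps_nth 1 n" if "n < k" for k
  proof (rule fps_ext)
    fix m
    have "ns = []" if "sum_list (map ((+) k) ns) = n" for ns
      using that \<open>n < k\<close> by (cases ns) auto
    then have "{xs \<in> map ((+) k) ` Collect is_001_partition. length xs = m \<and> sum_list xs = n} =
        (if m = 0 \<and> n = 0 then {[]} else {})"
      by force
    then show "fps_nth (fps_nth (shifted_gf k (Collect is_001_partition)) n) m = fps_nth (fps_nth 1 n) m"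
      by (simp add: shifted_gf_def list_gf_nth)
  qed
  then show "\<forall>\<^sub>F k in sequentially.
      fps_nth (shifted_gf k (Collect is_001_partition)) n = fps_nth 1 n"
    using eventually_gt_at_top by (rule eventually_mono[rotated])
qed

lemma tendsto_qpoch:
  fixes a q :: "'a :: idom fps"
  assumes "fps_nth a 0 = 0" "fps_nth q 0 = 0"
  shows "(\<lambda>k. \<Prod>i<k. 1 - a * q ^ i) \<longlonglongrightarrow> qpoch_inf a q"
  using has_prod_qpoch_inf[OF assms] by (rule has_prod_imp_tendsto')

lemma fps_nth_0_qpoch_inf:
  fixes a q :: "'a :: idom fps"
  assumes "fps_nth a 0 = 0" "fps_nth q 0 = 0"
  shows "fps_nth (qpoch_inf a q) 0 = 1"
proof -
  \<comment> \<open>Convergence makes each coefficient eventually equal to that of a partial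
    product.\<close>
  obtain k where "fps_nth (\<Prod>i<k. 1 - a * q ^ i) 0 = fps_nth (qpoch_inf a q) 0"
    using tendsto_qpoch[OF assms] unfolding tendsto_fps_iff eventually_sequentially by blast
  moreover have "fps_nth (\<Prod>i<k. 1 - a * q ^ i) 0 = 1"
    by (induction k) (simp_all add: assms(1))
  ultimately show ?thesis by simp
qed

lemma fps2_divide_eq:
  fixes F N D :: "rat fps fps"
  assumes "D * F = N" and D0: "fps_nth D 0 = 1"
  shows "N / D = F"
proof -
  \<comment> \<open>The coefficients are power series rather than field elements, so invertibility
    of \<open>D\<close> comes from its constant coefficient being 1.\<close>
  have "inverse D = fps_right_inverse D 1"
    using D0 by (subst fps_inverse_def) simp
  then have "inverse D * D = 1"
    using fps_left_inverse'[of 1 D 1] D0 by simp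
  have "N / D = N * inverse D"
    using D0 by (simp add: fps_divide_unit)
  also have "\<dots> = (inverse D * D) * F"
    unfolding assms(1)[symmetric] by (simp only: mult_ac)
  finally show ?thesis
    using \<open>inverse D * D = 1\<close> by simp
qed

text \<open>The double negation matches the partial products of \<open>qpoch_inf\<close>.\<close>

definition numerator_prod :: "nat \<Rightarrow> rat fps fps" where
  "numerator_prod k = (\<Prod>i<k. 1 - (- (z_var ^ 2 * q_var)) * (q_var ^ 2) ^ i)"

definition denominator_prod :: "nat \<Rightarrow> rat fps fps" where
  "denominator_prod k = (\<Prod>i<k. 1 - z_var * q_var * q_var ^ i) *
    (\<Prod>i<k. 1 - z_var ^ 3 * q_var * (q_var ^ 3) ^ i) *
    (\<Prod>i<k. 1 - z_var ^ 3 * q_var ^ 2 * (q_var ^ 3) ^ i)"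

lemma numerator_prod_Suc:
  "numerator_prod (Suc k) = numerator_prod k * (1 + (z_var * q_var ^ k) ^ 2 * q_var)"
proof -
  have "(- (z_var ^ 2 * q_var)) * (q_var ^ 2) ^ k = - ((z_var * q_var ^ k) ^ 2 * q_var)"
    by (simp add: power_mult_distrib power_commutes mult_ac flip: power_mult)
  then show ?thesis
    unfolding numerator_prod_def prod.lessThan_Suc by (simp only: diff_minus_eq_add)
qed

text \<open>The new factors are exactly the denominator of W at z q^k.\<close>

lemma denominator_prod_Suc:
  fixes k
  defines "u \<equiv> z_var * q_var ^ k"
  shows "denominator_prod (Suc k) = denominator_prod k *
    ((1 - u * q_var) * (1 - u ^ 3 * q_var) * (1 - u ^ 3 * q_var ^ 2))"
proof -
  have u1: "z_var * q_var * q_var ^ k = u * q_var"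
    by (simp only: u_def mult_ac)
  have u3: "u ^ 3 = z_var ^ 3 * (q_var ^ 3) ^ k"
    by (simp only: u_def power_mult_distrib mult.commute flip: power_mult)
  have "z_var ^ 3 * x * (q_var ^ 3) ^ k = u ^ 3 * x" for x
    by (simp only: u3 mult_ac)
  then show ?thesis
    unfolding denominator_prod_def prod.lessThan_Suc u1 by (simp only: mult_ac)
qed

text \<open>F(z) is F(z q^k) times the W(z q^i) with i < k, cross-multiplied to avoid
  division.\<close>

lemma iterated_functional_equation:
  "denominator_prod k * shifted_gf 0 (Collect is_001_partition) =
    numerator_prod k * shifted_gf k (Collect is_001_partition)"
proof (induction k)
  case 0
  show ?case by (simp add: denominator_prod_def numerator_prod_def)
next
  case (Suc k)
  define u where "u = z_var * q_var ^ k"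
  define d where "d = (1 - u * q_var) * (1 - u ^ 3 * q_var) * (1 - u ^ 3 * q_var ^ 2)"
  let ?F = "\<lambda>k. shifted_gf k (Collect is_001_partition)"
  have "denominator_prod (Suc k) * ?F 0 = d * (denominator_prod k * ?F 0)"
    unfolding denominator_prod_Suc u_def[symmetric] d_def[symmetric] by (simp only: mult_ac)
  also have "\<dots> = numerator_prod k * ?F (Suc k) * (d * shifted_gf k partitions_001_01)"
    unfolding Suc.IH shifted_gf_001_step[of k] by (simp only: mult_ac)
  also have "d * shifted_gf k partitions_001_01 = 1 + u ^ 2 * q_var"
    unfolding d_def u_def by (rule shifted_gf_01)
  also have "numerator_prod k * ?F (Suc k) * (1 + u ^ 2 * q_var) = numerator_prod (Suc k) * ?F (Suc k)"
    unfolding numerator_prod_Suc u_def[symmetric] by (simp only: mult_ac)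
  finally show ?case .
qed

theorem theorem27:
  shows "fps2 (\<lambda>m n. of_nat (J'' m n)) =
    qpoch_inf (- (z_var ^ 2 * q_var)) (q_var ^ 2) /
    (qpoch_inf (z_var * q_var) q_var *
     qpoch_inf (z_var ^ 3 * q_var) (q_var ^ 3) *
     qpoch_inf (z_var ^ 3 * q_var ^ 2) (q_var ^ 3))"
    (is "_ = ?N / ?D")
proof -
  let ?F = "\<lambda>k. shifted_gf k (Collect is_001_partition)"
  have q0: "fps_nth (x * q_var) 0 = 0" "fps_nth (- (x * q_var)) 0 = 0"
    "fps_nth (x * q_var ^ 2) 0 = 0" "fps_nth q_var 0 = 0"
    "fps_nth (q_var ^ 2) 0 = 0" "fps_nth (q_var ^ 3) 0 = 0" for x
    by (simp_all add: q_var_def)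
  have F0: "?F 0 = fps2 (\<lambda>m n. of_nat (J'' m n))"
    by (simp add: shifted_gf_def list_gf_def J''_def partitions_001_def map_idI)
  have "denominator_prod \<longlonglongrightarrow> ?D"
    unfolding denominator_prod_def by (intro tendsto_fps_mult tendsto_qpoch q0)
  then have "(\<lambda>k. denominator_prod k * ?F 0) \<longlonglongrightarrow> ?D * ?F 0"
    by (intro tendsto_fps_mult tendsto_const)
  \<comment> \<open>The same sequence rewritten by the iterated equation, where F(z q^k) tends to 1;
    comparing limits gives the product formula.\<close>
  moreover have "(\<lambda>k. denominator_prod k * ?F 0) \<longlonglongrightarrow> ?N * 1"
    unfolding iterated_functional_equation numerator_prod_def
    by (intro tendsto_fps_mult tendsto_qpoch tendsto_shifted_gf_001 q0)
  ultimately have "?D * ?F 0 = ?N * 1"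
    by (rule LIMSEQ_unique)
  then have "?D * ?F 0 = ?N"
    by (simp only: mult_1_right)
  moreover have "fps_nth ?D 0 = 1"
    by (simp only: fps_mult_nth_0 fps_nth_0_qpoch_inf q0 mult_zero_right mult_1_right)
  ultimately have "?N / ?D = ?F 0"
    by (rule fps2_divide_eq)
  then show ?thesis
    unfolding F0 by (rule sym)
qed

end
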